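(* For each $n\equiv 2 \pmod{3}$ with $n\geq 8$, a minimum $(C_6,\overline{C}_6)$-multicovering of $K_n$ has a padding of cardinality $2$. Furthermore, a minimum $(C_6,\overline{C}_6)$-multicovering of $K_7$ has a padding of cardinality $6$, and a minimum $(C_6,\overline{C}_6)$-multicovering of either $K_9$ or $K_{10}$ has a padding of cardinality $3$.
   Context: $C_6$ denotes the cycle on 6 vertices and $\overline{C}_6$ denotes its complement in $K_6$ (two disjoint triangles $\{a,b,c\}$, $\{d,e,f\}$ together with the edges $\{a,d\},\{b,e\},\{c,f\}$; 9 edges). For graphs $G$ and $H$, a $(G,H)$-multicovering of $K_n$ is a partition of a multiset of edges, consisting of all edges of $K_n$ with some edges possibly repeated, into edge-disjoint copies (as multisets) of $G$ and $H$, such that at least one copy of $G$ and at least one copy of $H$ occur. The padding is the multiset of repeated (extra) edges. A multicovering is minimum if its padding has minimum cardinality among all $(G,H)$-multicoverings of $K_n$. *)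

theory Defs
  imports "HOL-Library.Multiset" "HOL-Library.Ramsey"
begin

text \<open>Finite simple graphs are pairs of a vertex set and a set of two-element edges.\<close>

type_synonym 'a ugraph = "'a set \<times> 'a set set"

abbreviation verts :: "'a ugraph \<Rightarrow> 'a set" where "verts G \<equiv> fst G"
abbreviation edges :: "'a ugraph \<Rightarrow> 'a set set" where "edges G \<equiv> snd G"

definition complete_graph :: "nat \<Rightarrow> nat ugraph" where
  "complete_graph n = ({..<n}, nsets {..<n} 2)"

definition cycle_graph :: "nat \<Rightarrow> nat ugraph" where
  "cycle_graph n = ({..<n}, {{i, (i + 1) mod n} | i. i < n})"

definition complement :: "'a ugraph \<Rightarrow> 'a ugraph" where
  "complement G = (verts G, nsets (verts G) 2 - edges G)"

text \<open>The edges of the second graph are exactly the images of those of the first, so a graph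
  isomorphic to a finite simple graph is itself one.\<close>

definition isomorphic :: "'a ugraph \<Rightarrow> 'b ugraph \<Rightarrow> bool" where
  "isomorphic G H \<longleftrightarrow> (\<exists>f. bij_betw f (verts G) (verts H) \<and> edges H = (`) f ` edges G)"

definition subgraph :: "'a ugraph \<Rightarrow> 'a ugraph \<Rightarrow> bool" where
  "subgraph B K \<longleftrightarrow> verts B \<subseteq> verts K \<and> edges B \<subseteq> edges K"

definition copy_in :: "'a ugraph \<Rightarrow> 'b ugraph \<Rightarrow> 'b ugraph \<Rightarrow> bool" where
  "copy_in G K B \<longleftrightarrow> subgraph B K \<and> isomorphic G B"

text \<open>A covering is a multiset of blocks, since the same copy may be used more than once. It
  partitions the multiset sum of the edge sets of its blocks; an edge lying in several blocks is
  repeated in that multiset accordingly.\<close>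

definition covered_edges :: "'a ugraph multiset \<Rightarrow> 'a set multiset" where
  "covered_edges F = (\<Sum>B\<in>#F. mset_set (edges B))"

definition multicovering ::
  "'a ugraph \<Rightarrow> 'b ugraph \<Rightarrow> 'c ugraph \<Rightarrow> 'c ugraph multiset \<Rightarrow> bool" where
  "multicovering G H K F \<longleftrightarrow>
     (\<forall>B\<in>#F. copy_in G K B \<or> copy_in H K B) \<and>
     (\<exists>B\<in>#F. copy_in G K B) \<and>
     (\<exists>B\<in>#F. copy_in H K B) \<and>
     set_mset (covered_edges F) = edges K"

definition padding :: "'a ugraph \<Rightarrow> 'a ugraph multiset \<Rightarrow> 'a set multiset" where
  "padding K F = covered_edges F - mset_set (edges K)"

definition minimum_multicovering ::
  "'a ugraph \<Rightarrow> 'b ugraph \<Rightarrow> 'c ugraph \<Rightarrow> 'c ugraph multiset \<Rightarrow> bool" where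
  "minimum_multicovering G H K F \<longleftrightarrow>
     multicovering G H K F \<and>
     (\<forall>F'. multicovering G H K F' \<longrightarrow> size (padding K F) \<le> size (padding K F'))"

text \<open>A minimum multicovering of \<open>K\<close> exists and every such one has a padding of size \<open>k\<close>.\<close>

definition minimum_padding_size ::
  "'a ugraph \<Rightarrow> 'b ugraph \<Rightarrow> 'c ugraph \<Rightarrow> nat \<Rightarrow> bool" where
  "minimum_padding_size G H K k \<longleftrightarrow>
     (\<exists>F. minimum_multicovering G H K F) \<and>
     (\<forall>F. minimum_multicovering G H K F \<longrightarrow> size (padding K F) = k)"

abbreviation C6 :: "nat ugraph" where "C6 \<equiv> cycle_graph 6"
abbreviation C6_bar :: "nat ugraph" where "C6_bar \<equiv> complement C6"

text \<open>The complement of the 6-cycle consists of the triangles on 0, 2, 4 and 3, 5, 1, joined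
  by a perfect matching.\<close>

lemma edges_C6: "edges C6 = {{0,1},{1,2},{2,3},{3,4},{4,5},{5,0}}"
proof -
  have "edges C6 = (\<lambda>i. {i, (i + 1) mod 6}) ` {0,1,2,3,4,5}"
  proof -
    have "{0,1,2,3,4,5} = {i::nat. i < 6}" by auto
    then show ?thesis by (auto simp: cycle_graph_def)
  qed
  also have "\<dots> = {{0,(0+1) mod 6},{1,(1+1) mod 6},{2,(2+1) mod 6},{3,(3+1) mod 6},
      {4,(4+1) mod 6},{5,(5+1) mod 6}}"
    by (simp only: image_insert image_empty)
  also have "\<dots> = {{0,1},{1,2},{2,3},{3,4},{4,5},{5,0}}"
    by (simp del: One_nat_def add: One_nat_def [symmetric])
  finally show ?thesis .
qed

lemma edges_C6_bar:
  "edges C6_bar = {{0,2},{2,4},{0,4}, {3,5},{5,1},{3,1}, {0,3},{2,5},{4,1}}"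
proof -
  have "nsets {..<6::nat} 2 = (\<Union>y<6. \<Union>x<y. {{x,y}})"
    unfolding ordered_nsets_2_eq by fastforce
  also have "\<dots> = {{0,1},{0,2},{1,2},{0,3},{1,3},{2,3},{0,4},{1,4},{2,4},{3,4},
      {0,5},{1,5},{2,5},{3,5},{4,5}}"
    by (simp add: lessThan_nat_numeral lessThan_Suc)
  finally have n: "nsets {..<6::nat} 2 = \<dots>" .
  have "edges C6_bar = nsets {..<6} 2 - {{0,1},{1,2},{2,3},{3,4},{4,5},{5,0}}"
    unfolding complement_def edges_C6 by (simp add: cycle_graph_def)
  also have "\<dots> = {{0,2},{0,3},{1,3},{0,4},{1,4},{2,4},{1,5},{2,5},{3,5}}"
    unfolding n by (simp add: insert_Diff_if doubleton_eq_iff)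
  also have "\<dots> = {{0,2},{2,4},{0,4}, {3,5},{5,1},{3,1}, {0,3},{2,5},{4,1}}"
  proof -
    have *: "{5,1::nat} = {1,5}" "{3,1::nat} = {1,3}" "{4,1::nat} = {1,4}" by auto
    show ?thesis unfolding *
      by (intro equalityI subsetI; elim insertE emptyE; simp only: insert_iff simp_thms refl)
  qed
  finally show ?thesis .
qed

end

theory Submission
  imports Defs
begin

text \<open>
  Lower bounds: \<open>a\<close> hexagons and \<open>b\<close> prisms cover \<open>6 a + 9 b\<close> edges, so the padding size is
  determined modulo 3, and a vertex lying in \<open>h\<close> hexagons and \<open>p\<close> prisms has degree
  \<open>2 h + 3 p\<close> in the covering. For \<open>K\<^sub>7\<close>, a vertex missed by some prism needs
  \<open>2 a + 3 (b - 1) \<ge> 6\<close>. An exact decomposition of \<open>K\<^sub>9\<close> would have two prisms with, by parity, the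
  same six vertices, but \<open>18 > 15\<close>. One of \<open>K\<^sub>1\<^sub>0\<close> would have three prisms with each vertex
  in one or all of them, hence four common vertices; each prism has at least three edges among
  those four, but \<open>9 > 6\<close>.

  Upper bounds: explicit coverings of \<open>K\<^sub>7\<close> to \<open>K\<^sub>1\<^sub>1\<close>, extended from \<open>K\<^sub>n\<close> to \<open>K\<^sub>n\<^sub>+\<^sub>6\<close> without
  new padding. The six new vertices span a hexagon and the complementary prism; when \<open>n\<close> is even,
  the edges between old and new vertices split into hexagons. When \<open>n\<close> is odd, the new edges
  at three of the old vertices are first combined with the new \<open>K\<^sub>6\<close> into three prisms and a hexagon,
  leaving an even number of old vertices.
\<close>

section \<open>Edge multisets of placed copies and their list encodings\<close>

definition placed :: "'a ugraph \<Rightarrow> ('a \<Rightarrow> 'b) \<Rightarrow> 'b ugraph" where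
  "placed G f = (f ` verts G, (`) f ` edges G)"

lemma isomorphic_placed: "inj_on f (verts G) \<Longrightarrow> isomorphic G (placed G f)"
  unfolding isomorphic_def placed_def by (auto simp: bij_betw_def)

abbreviation edge_of :: "'a \<times> 'a \<Rightarrow> 'a set" where
  "edge_of p \<equiv> {fst p, snd p}"

text \<open>Ordered pairs serve as codes of edges, so that edge multisets can be compared by
  evaluation. With the smaller endpoint first, every edge has exactly one code.\<close>

definition increasing :: "(nat \<times> nat) list \<Rightarrow> bool" where
  "increasing es \<longleftrightarrow> distinct es \<and> (\<forall>p\<in>set es. fst p < snd p)"

lemma inj_on_edge_of:
  assumes "increasing es"
  shows "inj_on edge_of (set es)"
  using assms unfolding increasing_def inj_on_def
  by (metis doubleton_eq_iff less_asym prod.expand)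

text \<open>\<open>mset_set\<close> commutes with an image only under injectivity. This enters
  twice: from codes to two-element sets, and from these sets to their images under
  \<open>f\<close>.\<close>

lemma mset_set_edges:
  assumes "increasing es" "inj_on f (\<Union>(edge_of ` set es))"
  shows "mset_set ((`) f ` edge_of ` set es) = image_mset (\<lambda>p. f ` edge_of p) (mset es)"
proof -
  have "inj_on edge_of (set es)"
    using assms(1) by (rule inj_on_edge_of)
  moreover have "inj_on ((`) f) (edge_of ` set es)"
    using assms(2) by (rule inj_on_image)
  ultimately have "inj_on (\<lambda>p. f ` edge_of p) (set es)"
    using comp_inj_on[of edge_of "set es" "(`) f"] by (simp add: comp_def)
  then have "mset_set ((\<lambda>p. f ` edge_of p) ` set es)
      = image_mset (\<lambda>p. f ` edge_of p) (mset_set (set es))"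
    by (simp add: image_mset_mset_set)
  also have "mset_set (set es) = mset es"
    using assms(1) by (simp add: increasing_def mset_set_set)
  finally show ?thesis by (simp add: image_image)
qed

definition hexagon_pairs :: "(nat \<times> nat) list" where
  "hexagon_pairs = [(0,1),(1,2),(2,3),(3,4),(4,5),(0,5)]"

definition prism_pairs :: "(nat \<times> nat) list" where
  "prism_pairs = [(0,2),(2,4),(0,4),(3,5),(1,5),(1,3),(0,3),(2,5),(1,4)]"

lemma verts_C6: "verts C6 = {..<6}"
  by (simp add: cycle_graph_def)

lemma verts_C6_bar: "verts C6_bar = {..<6}"
  by (simp add: complement_def cycle_graph_def)

lemma edges_C6_pairs: "edges C6 = edge_of ` set hexagon_pairs"
  unfolding edges_C6 hexagon_pairs_def by (simp add: insert_commute)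

lemma edges_C6_bar_pairs: "edges C6_bar = edge_of ` set prism_pairs"
  unfolding edges_C6_bar prism_pairs_def by (simp add: insert_commute)

lemma increasing_pairs: "increasing hexagon_pairs" "increasing prism_pairs"
  unfolding increasing_def hexagon_pairs_def prism_pairs_def by simp_all

lemma pairs_bounded:
  "\<Union>(edge_of ` set hexagon_pairs) \<subseteq> {..<6}" "\<Union>(edge_of ` set prism_pairs) \<subseteq> {..<6}"
  unfolding hexagon_pairs_def prism_pairs_def by auto

lemma mset_set_edges_placed:
  assumes "inj_on g {..<6::nat}"
  shows "mset_set (edges (placed C6 g)) = image_mset (\<lambda>p. g ` edge_of p) (mset hexagon_pairs)"
    and "mset_set (edges (placed C6_bar g)) = image_mset (\<lambda>p. g ` edge_of p) (mset prism_pairs)"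
  using assms unfolding placed_def edges_C6_pairs edges_C6_bar_pairs snd_conv
  by (intro mset_set_edges increasing_pairs inj_on_subset[OF _ pairs_bounded(1)]
      inj_on_subset[OF _ pairs_bounded(2)]; assumption)+

text \<open>A list \<open>xs\<close> of six vertices encodes the copy in which vertex \<open>i\<close> of \<open>C6\<close> or \<open>C6_bar\<close>
  is placed at \<open>xs ! i\<close>.\<close>

definition relabel :: "nat list \<Rightarrow> nat \<times> nat \<Rightarrow> nat \<times> nat" where
  "relabel xs p = (min (xs ! fst p) (xs ! snd p), max (xs ! fst p) (xs ! snd p))"

text \<open>Since \<open>relabel\<close> sorts each code, the question whether blocks cover a given
  edge multiset becomes an equation between \<open>mset\<close>s of concrete lists, which
  \<open>code_simp\<close> decides.\<close>

definition layout :: "nat list list \<Rightarrow> nat list list \<Rightarrow> (nat \<times> nat) list" where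
  "layout hs ps = concat (map (\<lambda>xs. map (relabel xs) hexagon_pairs) hs)
     @ concat (map (\<lambda>xs. map (relabel xs) prism_pairs) ps)"

definition six_in :: "nat \<Rightarrow> nat list \<Rightarrow> bool" where
  "six_in n xs \<longleftrightarrow> length xs = 6 \<and> distinct xs \<and> (\<forall>x\<in>set xs. x < n)"

text \<open>The map \<open>f\<close> carries a pattern found on indices to an arbitrary vertex
  set.\<close>

definition blocks :: "(nat \<Rightarrow> 'a) \<Rightarrow> nat list list \<Rightarrow> nat list list \<Rightarrow> 'a ugraph multiset" where
  "blocks f hs ps = mset (map (\<lambda>xs. placed C6 (f \<circ> (!) xs)) hs)
     + mset (map (\<lambda>xs. placed C6_bar (f \<circ> (!) xs)) ps)"

lemma edge_of_relabel: "edge_of (relabel xs p) = (!) xs ` edge_of p"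
  by (auto simp: relabel_def min_def max_def)

lemma inj_on_six_in:
  assumes "inj_on f {..<n}" "six_in n xs"
  shows "inj_on (f \<circ> (!) xs) {..<6}"
proof (rule comp_inj_on)
  show "inj_on ((!) xs) {..<6}"
    using assms(2) by (auto simp: six_in_def inj_on_def nth_eq_iff_index_eq)
  have "(!) xs ` {..<6} \<subseteq> {..<n}"
    using assms(2) by (auto simp: six_in_def)
  then show "inj_on f ((!) xs ` {..<6})"
    using assms(1) inj_on_subset by blast
qed

lemma covered_edges_empty [simp]: "covered_edges {#} = {#}"
  by (simp add: covered_edges_def)

lemma covered_edges_add_mset [simp]:
  "covered_edges (add_mset B F) = mset_set (edges B) + covered_edges F"
  by (simp add: covered_edges_def)

lemma covered_edges_union [simp]:
  "covered_edges (F + G) = covered_edges F + covered_edges G"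
  by (simp add: covered_edges_def)

text \<open>As \<open>f\<close> is injective on the indices, no block merges two of its edges, so
  each contributes exactly its relabelled codes. This links abstract blocks to computable
  lists.\<close>

lemma covered_edges_blocks:
  assumes "inj_on f {..<n}" "list_all (six_in n) hs" "list_all (six_in n) ps"
  shows "covered_edges (blocks f hs ps)
    = image_mset (\<lambda>p. f ` edge_of p) (mset (layout hs ps))"
proof -
  have "covered_edges (mset (map (\<lambda>xs. placed C6 (f \<circ> (!) xs)) hs))
      = image_mset (\<lambda>p. f ` edge_of p)
          (mset (concat (map (\<lambda>xs. map (relabel xs) hexagon_pairs) hs)))"
    using assms(2)
  proof (induction hs)
    case (Cons xs hs)
    then have "inj_on (f \<circ> (!) xs) {..<6}"
      using inj_on_six_in[OF assms(1)] by simp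
    with Cons show ?case
      by (simp only: list.map mset.simps covered_edges_add_mset mset_set_edges_placed list.pred_inject(2)
          concat.simps mset_append mset_map image_mset_union multiset.map_comp comp_def
          edge_of_relabel image_image simp_thms)
  qed simp
  moreover have "covered_edges (mset (map (\<lambda>xs. placed C6_bar (f \<circ> (!) xs)) ps))
      = image_mset (\<lambda>p. f ` edge_of p)
          (mset (concat (map (\<lambda>xs. map (relabel xs) prism_pairs) ps)))"
    using assms(3)
  proof (induction ps)
    case (Cons xs ps)
    then have "inj_on (f \<circ> (!) xs) {..<6}"
      using inj_on_six_in[OF assms(1)] by simp
    with Cons show ?case
      by (simp only: list.map mset.simps covered_edges_add_mset mset_set_edges_placed list.pred_inject(2)
          concat.simps mset_append mset_map image_mset_union multiset.map_comp comp_def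
          edge_of_relabel image_image simp_thms)
  qed simp
  ultimately show ?thesis
    by (simp only: blocks_def layout_def covered_edges_union mset_append image_mset_union)
qed

lemma set_mset_blocks:
  "set_mset (blocks f hs ps) = (\<lambda>xs. placed C6 (f \<circ> (!) xs)) ` set hs
     \<union> (\<lambda>xs. placed C6_bar (f \<circ> (!) xs)) ` set ps"
  by (simp add: blocks_def)

lemma isomorphic_six_in:
  assumes "inj_on f {..<n}" "six_in n xs"
  shows "isomorphic C6 (placed C6 (f \<circ> (!) xs))"
    and "isomorphic C6_bar (placed C6_bar (f \<circ> (!) xs))"
  using inj_on_six_in[OF assms]
  by (auto intro!: isomorphic_placed simp only: verts_C6 verts_C6_bar)

section \<open>Exact decompositions of edge sets\<close>

text \<open>Unlike in \<open>multicovering\<close>, there is no host graph and one kind of block may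
  be absent, so decompositions of disjoint pieces simply add up. Where the blocks lie is recovered
  later from their edges.\<close>

definition tiles :: "'a ugraph multiset \<Rightarrow> 'a set multiset \<Rightarrow> bool" where
  "tiles F M \<longleftrightarrow> (\<forall>B\<in>#F. isomorphic C6 B \<or> isomorphic C6_bar B) \<and> covered_edges F = M"

definition tileable :: "'a set set \<Rightarrow> bool" where
  "tileable E \<longleftrightarrow> (\<exists>F. tiles F (mset_set E))"

lemma tileable_Un:
  assumes "tileable E" "tileable E'" "finite E" "finite E'" "E \<inter> E' = {}"
  shows "tileable (E \<union> E')"
proof -
  obtain F F' where "tiles F (mset_set E)" "tiles F' (mset_set E')"
    using assms(1,2) by (auto simp: tileable_def)
  then have "tiles (F + F') (mset_set (E \<union> E'))"
    using assms(3-5) by (auto simp: tiles_def mset_set_Union)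
  then show ?thesis by (auto simp: tileable_def)
qed

text \<open>Reduces a decomposition of an abstract edge set to computable conditions on a witness
  over the indices below \<open>n\<close>, transported along \<open>f\<close>.\<close>

lemma tileable_by_layout:
  assumes "list_all (six_in n) hs" "list_all (six_in n) ps" "inj_on f {..<n}"
    and "mset (layout hs ps) = mset es" "increasing es" "\<forall>p\<in>set es. snd p < n"
  shows "tileable ((`) f ` edge_of ` set es)"
proof -
  have "\<Union>(edge_of ` set es) \<subseteq> {..<n}"
    using assms(5,6) by (fastforce simp: increasing_def)
  then have "inj_on f (\<Union>(edge_of ` set es))"
    using assms(3) inj_on_subset by blast
  then have "covered_edges (blocks f hs ps) = mset_set ((`) f ` edge_of ` set es)"
    by (simp only: mset_set_edges[OF assms(5)] covered_edges_blocks[OF assms(3,1,2)] assms(4))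
  moreover have "\<forall>B\<in>#blocks f hs ps. isomorphic C6 B \<or> isomorphic C6_bar B"
    using assms(1,2) isomorphic_six_in[OF assms(3)]
    by (auto simp: set_mset_blocks list_all_iff)
  ultimately have "tiles (blocks f hs ps) (mset_set ((`) f ` edge_of ` set es))"
    by (simp add: tiles_def)
  then show ?thesis by (auto simp: tileable_def)
qed

section \<open>Edges between two vertex sets and within one\<close>

definition join :: "'a set \<Rightarrow> 'a set \<Rightarrow> 'a set set" where
  "join A B = (\<Union>x\<in>A. (\<lambda>y. {x, y}) ` B)"

lemma image_join: "(`) f ` join A B = join (f ` A) (f ` B)"
  by (simp add: join_def image_UN image_image)

lemma finite_join: "finite A \<Longrightarrow> finite B \<Longrightarrow> finite (join A B)"
  by (simp add: join_def)

lemma join_Un: "join (A \<union> A') B = join A B \<union> join A' B"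
  by (auto simp: join_def)

lemma join_commute: "join A B = join B A"
  by (auto simp: join_def doubleton_eq_iff image_iff)

lemma join_disjoint:
  assumes "A \<inter> A' = {}" "A \<inter> B = {}"
  shows "join A B \<inter> join A' B = {}"
  using assms by (auto simp: join_def doubleton_eq_iff)

lemma nsets_image:
  assumes "inj_on f S"
  shows "(`) f ` nsets S k = nsets (f ` S) k"
proof (intro equalityI subsetI)
  fix e assume "e \<in> (`) f ` nsets S k"
  then show "e \<in> nsets (f ` S) k"
    using assms by (auto simp: nsets_def card_image inj_on_subset)
next
  fix e assume "e \<in> nsets (f ` S) k"
  then obtain d where "d \<subseteq> S" "e = f ` d" "finite e" "card e = k"
    by (auto simp: nsets_def subset_image_iff)
  moreover from this have "inj_on f d"
    using assms inj_on_subset by blast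
  ultimately show "e \<in> (`) f ` nsets S k"
    by (auto simp: nsets_def card_image dest: finite_imageD)
qed

lemma nsets_2_eq: "nsets A 2 = {{x, y} | x y. x \<in> A \<and> y \<in> A \<and> x \<noteq> y}"
  by (auto simp: nsets_def card_2_iff)

lemma nsets_2_Un: "A \<inter> B = {} \<Longrightarrow> nsets (A \<union> B) 2 = nsets A 2 \<union> nsets B 2 \<union> join A B"
  unfolding nsets_2_eq join_def
  by (intro equalityI subsetI; clarsimp simp: image_iff; blast)

definition pairs :: "nat \<Rightarrow> (nat \<times> nat) list" where
  "pairs n = concat (map (\<lambda>j. map (\<lambda>i. (i, j)) [0..<j]) [0..<n])"

lemma set_pairs: "set (pairs n) = {(i, j). i < j \<and> j < n}"
  by (auto simp: pairs_def)

lemma increasing_all_pairs: "increasing (pairs n)"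
proof -
  \<comment> \<open>\<open>pairs (Suc n)\<close> is \<open>pairs n\<close> followed by the pairs
    with larger entry \<open>n\<close>.\<close>
  have "distinct (pairs n)"
    by (induction n) (auto simp: pairs_def distinct_map inj_on_def)
  then show ?thesis by (auto simp: increasing_def set_pairs)
qed

lemma edge_of_pairs: "edge_of ` set (pairs n) = nsets {..<n} 2"
  unfolding nsets_2_eq
proof (intro equalityI subsetI)
  fix e :: "nat set" assume "e \<in> {{x, y} | x y. x \<in> {..<n} \<and> y \<in> {..<n} \<and> x \<noteq> y}"
  then obtain x y where "e = {x, y}" "x < n" "y < n" "x \<noteq> y" by auto
  then show "e \<in> edge_of ` set (pairs n)"
    by (intro image_eqI[where x = "(min x y, max x y)"])
      (auto simp: set_pairs min_def max_def)
next
  fix e :: "nat set" assume "e \<in> edge_of ` set (pairs n)"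
  then obtain i j where "e = {i, j}" "i < j" "j < n" by (auto simp: set_pairs)
  then show "e \<in> {{x, y} | x y. x \<in> {..<n} \<and> y \<in> {..<n} \<and> x \<noteq> y}"
    by (fastforce intro: less_trans)
qed

text \<open>Gives \<open>A\<close> and \<open>B\<close> consecutive ranges of indices, on which the
  decompositions are computed.\<close>

lemma enumerate_two:
  assumes "finite A" "finite B" "A \<inter> B = {}"
  obtains f :: "nat \<Rightarrow> 'a" where "inj_on f {..<card A + card B}"
    "f ` {..<card A} = A" "f ` {card A..<card A + card B} = B"
proof -
  obtain xs ys where xs: "set xs = A" "distinct xs" and ys: "set ys = B" "distinct ys"
    using assms finite_distinct_list by metis
  have len: "length xs = card A" "length ys = card B"
    using xs ys distinct_card by fastforce+
  define f where "f = (!) (xs @ ys)"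
  have "distinct (xs @ ys)" using xs ys assms(3) by simp
  then have "inj_on f {..<card A + card B}"
    using len by (simp add: f_def inj_on_def nth_eq_iff_index_eq)
  moreover have "f ` {..<card A} = (!) xs ` {..<length xs}"
    by (intro image_cong) (auto simp: f_def len nth_append)
  moreover have "f ` {card A..<card A + card B} = (\<lambda>i. f (i + card A)) ` {..<card B}"
    by (simp only: image_image[symmetric, of f "\<lambda>i. i + card A"] lessThan_atLeast0
        image_add_atLeastLessThan' add_0 add.commute)
  moreover have "\<dots> = (!) ys ` {..<length ys}"
    by (intro image_cong) (auto simp: f_def nth_append simp flip: len)
  moreover have "(!) xs ` {..<length xs} = A" "(!) ys ` {..<length ys} = B"
    using xs(1) ys(1) by (auto simp: set_conv_nth)
  ultimately show ?thesis using that by metis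
qed

lemma edge_of_product: "edge_of ` set (List.product xs ys) = join (set xs) (set ys)"
  by (auto simp: join_def image_iff; blast)

section \<open>Decomposing the edges at six new vertices\<close>

lemma tileable_join_4_6:
  assumes "card A = 4" "card B = 6" "A \<inter> B = {}"
  shows "tileable (join A B)"
proof -
  have "finite A" "finite B" using assms by (auto intro: card_ge_0_finite)
  then obtain f where f: "inj_on f {..<10::nat}" "f ` {..<4} = A" "f ` {4..<10} = B"
    using enumerate_two[of A B] assms by auto
  have "tileable ((`) f ` edge_of ` set (List.product [0..<4] [4..<10]))"
  proof (rule tileable_by_layout[where ps = "[]" and n = 10])
    \<comment> \<open>The 24 edges form four hexagons that alternate between the indices below 4,
      standing for \<open>A\<close>, and the others. Each hexagon omits a different vertex of
      \<open>A\<close>.\<close>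
    let ?hs = "[[0,6,3,4,2,9],[2,6,1,9,3,8],[0,4,1,5,2,7],[0,5,3,7,1,8]]"
    show "list_all (six_in 10) ?hs" by code_simp
    show "mset (layout ?hs []) = mset (List.product [0..<4] [4..<10])" by code_simp
  qed (use f in \<open>auto simp: increasing_def distinct_product\<close>)
  then show ?thesis
    by (simp only: edge_of_product image_join set_upt lessThan_atLeast0 [symmetric] f)
qed

lemma tileable_join_6_6:
  assumes "card A = 6" "card B = 6" "A \<inter> B = {}"
  shows "tileable (join A B)"
proof -
  have "finite A" "finite B" using assms by (auto intro: card_ge_0_finite)
  then obtain f where f: "inj_on f {..<12::nat}" "f ` {..<6} = A" "f ` {6..<12} = B"
    using enumerate_two[of A B] assms by auto
  have "tileable ((`) f ` edge_of ` set (List.product [0..<6] [6..<12]))"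
  proof (rule tileable_by_layout[where ps = "[]" and n = 12])
    \<comment> \<open>Six alternating hexagons use up the 36 edges.\<close>
    let ?hs = "[[3,10,1,7,2,9],[2,10,4,9,1,6],[5,9,0,8,1,11],[0,10,5,6,4,7],[5,7,3,11,2,8],
      [4,8,3,6,0,11]]"
    show "list_all (six_in 12) ?hs" by code_simp
    show "mset (layout ?hs []) = mset (List.product [0..<6] [6..<12])" by code_simp
  qed (use f in \<open>auto simp: increasing_def distinct_product\<close>)
  then show ?thesis
    by (simp only: edge_of_product image_join set_upt lessThan_atLeast0 [symmetric] f)
qed

text \<open>Four vertices of \<open>A\<close> are split off at a time. Size 6 is a second base case:
  splitting off four would leave two, and a hexagon between \<open>A\<close> and \<open>B\<close>
  needs three vertices on each side.\<close>

lemma tileable_join: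
  assumes "even (card A)" "4 \<le> card A" "card B = 6" "A \<inter> B = {}"
  shows "tileable (join A B)"
  using assms
proof (induction "card A" arbitrary: A rule: less_induct)
  case less
  have fin: "finite A" "finite B" using less.prems by (auto intro: card_ge_0_finite)
  consider "card A = 4" | "card A = 6" | "8 \<le> card A"
  proof -
    have "card A = 4 \<or> card A = 6 \<or> 8 \<le> card A"
      using less.prems(1,2) by presburger
    then show ?thesis using that by blast
  qed
  then show ?case
  proof cases
    case 3
    then obtain S where S: "S \<subseteq> A" "card S = 4"
      by (metis less.prems(2) obtain_subset_with_card_n)
    have card: "card (A - S) = card A - 4"
      using S fin by (simp add: card_Diff_subset finite_subset)
    have "tileable (join (A - S) B)"
      using 3 card less.prems by (intro less.hyps) auto
    moreover have "tileable (join S B)"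
      using S less.prems by (intro tileable_join_4_6) auto
    moreover have "join (A - S) B \<inter> join S B = {}"
      using S less.prems(4) by (intro join_disjoint) auto
    moreover have "finite (join (A - S) B)" "finite (join S B)"
      using fin S by (auto intro: finite_join finite_subset)
    ultimately have "tileable (join (A - S) B \<union> join S B)"
      by (intro tileable_Un)
    moreover have "(A - S) \<union> S = A" using S by blast
    ultimately show ?thesis by (metis join_Un)
  qed (use less.prems in \<open>auto intro: tileable_join_4_6 tileable_join_6_6\<close>)
qed

lemma tileable_complete_6:
  assumes "card N = 6"
  shows "tileable (nsets N 2)"
proof -
  have "finite N" using assms by (auto intro: card_ge_0_finite)
  then obtain f where f: "inj_on f {..<6::nat}" "f ` {..<6} = N"
    using enumerate_two[of N "{}"] assms by auto
  have "tileable ((`) f ` edge_of ` set (pairs 6))"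
  proof (rule tileable_by_layout[where n = 6])
    \<comment> \<open>One labelling serves both blocks, because the prism is the complement of the
      hexagon on the same six vertices.\<close>
    show "list_all (six_in 6) [[0,1,2,3,4,5]]" by code_simp
    show "list_all (six_in 6) [[0,1,2,3,4,5]]" by code_simp
    show "mset (layout [[0,1,2,3,4,5]] [[0,1,2,3,4,5]]) = mset (pairs 6)" by code_simp
  qed (use f increasing_all_pairs in \<open>auto simp: set_pairs\<close>)
  then show ?thesis
    unfolding edge_of_pairs by (simp add: nsets_image f)
qed

text \<open>This is \<open>K\<^sub>9\<close> with the three edges inside \<open>A\<close> removed.\<close>

lemma tileable_complete_6_join_3:
  assumes "card N = 6" "card A = 3" "A \<inter> N = {}"
  shows "tileable (nsets N 2 \<union> join A N)"
proof -
  have "finite N" "finite A" "N \<inter> A = {}"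
    using assms by (auto intro: card_ge_0_finite)
  then obtain f where f: "inj_on f {..<9::nat}" "f ` {..<6} = N" "f ` {6..<9} = A"
    using enumerate_two[of N A] assms by auto
  have inj: "inj_on f {..<6}" using f(1) by (rule inj_on_subset) auto
  let ?es = "pairs 6 @ List.product [0..<6] [6..<9]"
  have "tileable ((`) f ` edge_of ` set ?es)"
  proof (rule tileable_by_layout[where n = 9])
    \<comment> \<open>The count is \<open>15 + 18 = 6 + 3 * 9\<close>. The hexagon stays inside
      \<open>N\<close>. Each prism holds two of the vertices 6, 7, 8 of \<open>A\<close> in
      non-adjacent places, and each of the three pairs occurs once; so these vertices get degree 6
      without an edge inside \<open>A\<close>.\<close>
    let ?hs = "[[1,3,0,2,5,4]]"
    let ?ps = "[[6,0,2,5,4,7],[5,0,3,1,8,6],[7,8,3,1,4,2]]"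
    show "list_all (six_in 9) ?hs" by code_simp
    show "list_all (six_in 9) ?ps" by code_simp
    show "mset (layout ?hs ?ps) = mset ?es" by code_simp
    show "increasing ?es"
      using increasing_all_pairs[of 6] by (auto simp: increasing_def distinct_product set_pairs)
  qed (use f in \<open>auto simp: set_pairs\<close>)
  moreover have "(`) f ` edge_of ` set ?es = nsets N 2 \<union> join N A"
    by (simp only: set_append image_Un edge_of_pairs edge_of_product image_join set_upt
        lessThan_atLeast0 [symmetric] nsets_image[OF inj] f)
  ultimately show ?thesis by (simp add: join_commute[of A])
qed

lemma tileable_extension:
  assumes "8 \<le> card A" "card N = 6" "A \<inter> N = {}"
  shows "tileable (nsets N 2 \<union> join A N)"
proof -
  have fin: "finite A" "finite N" using assms by (auto intro: card_ge_0_finite)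
  have disj: "nsets N 2 \<inter> join S N = {}" if "S \<subseteq> A" for S
    using that assms(3) unfolding nsets_2_eq join_def
    by (fastforce simp: doubleton_eq_iff)
  show ?thesis
  proof (cases "even (card A)")
    case True
    then show ?thesis
      using assms fin disj
      by (intro tileable_Un tileable_complete_6 tileable_join finite_join finite_imp_finite_nsets)
        auto
  next
    case False
    obtain S where S: "S \<subseteq> A" "card S = 3"
      using obtain_subset_with_card_n[of 3 A] assms(1) by auto
    have card: "card (A - S) = card A - 3"
      using S fin by (simp add: card_Diff_subset finite_subset)
    have "tileable (nsets N 2 \<union> join S N)"
      using S assms by (intro tileable_complete_6_join_3) auto
    \<comment> \<open>Here \<open>card A\<close> is odd and at least 9, so \<open>A - S\<close> has
      an even number of vertices, at least 6.\<close>
    moreover have "tileable (join (A - S) N)"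
      using card assms False by (intro tileable_join) auto
    moreover have "(nsets N 2 \<union> join S N) \<inter> join (A - S) N = {}"
    proof -
      have "join S N \<inter> join (A - S) N = {}"
        using S assms(3) by (intro join_disjoint) auto
      then show ?thesis using disj[of "A - S"] by blast
    qed
    moreover have "finite (join (A - S) N)" "finite (nsets N 2 \<union> join S N)"
      using fin S by (auto intro: finite_join finite_subset finite_imp_finite_nsets)
    ultimately have "tileable ((nsets N 2 \<union> join S N) \<union> join (A - S) N)"
      using tileable_Un by blast
    moreover have "(nsets N 2 \<union> join S N) \<union> join (A - S) N = nsets N 2 \<union> join A N"
    proof -
      have "S \<union> (A - S) = A" using S by blast
      then have "join A N = join S N \<union> join (A - S) N" by (metis join_Un)
      then show ?thesis by (simp only: Un_assoc)
    qed
    ultimately show ?thesis by simp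
  qed
qed

section \<open>Explicit coverings of small complete graphs\<close>

lemma edges_complete: "edges (complete_graph n) = nsets {..<n} 2"
  and verts_complete: "verts (complete_graph n) = {..<n}"
  by (simp_all add: complete_graph_def)

text \<open>The list \<open>es\<close> holds the repeated edges: subtracting the edges of the
  complete graph from the layout leaves exactly \<open>es\<close>, with multiplicity.\<close>

lemma base_covering:
  assumes "list_all (six_in n) hs" "list_all (six_in n) ps" "hs \<noteq> []" "ps \<noteq> []"
    and "mset (layout hs ps) = mset (pairs n @ es)"
    and "\<forall>p\<in>set es. fst p < snd p \<and> snd p < n" "length es = k"
  shows "\<exists>F. multicovering C6 C6_bar (complete_graph n) F
    \<and> size (padding (complete_graph n) F) = k"
proof -
  let ?F = "blocks id hs ps" and ?K = "complete_graph n"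
  have "mset_set (edges ?K) = image_mset edge_of (mset (pairs n))"
    using mset_set_edges[OF increasing_all_pairs, of id n]
    by (simp add: edges_complete edge_of_pairs)
  moreover have "covered_edges ?F = image_mset edge_of (mset (pairs n @ es))"
    using covered_edges_blocks[of id n hs ps] assms(1,2,5) by simp
  ultimately have covered: "covered_edges ?F = mset_set (edges ?K) + image_mset edge_of (mset es)"
    by simp
  have fin: "finite (edges ?K)" by (simp add: edges_complete finite_imp_finite_nsets)
  \<comment> \<open>Repeated edges are edges of the complete graph, so they do not enlarge the
    support.\<close>
  have "set es \<subseteq> set (pairs n)"
    using assms(6) by (auto simp: set_pairs)
  then have "edge_of ` set es \<subseteq> edges ?K"
    unfolding edges_complete edge_of_pairs[symmetric] by (rule image_mono)
  then have support: "set_mset (covered_edges ?F) = edges ?K"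
    using fin by (auto simp: covered)
  have sub: "verts (placed G (id \<circ> (!) xs)) \<subseteq> {..<n}"
    if "six_in n xs" "verts G = {..<6}" for G xs
    using that by (auto simp: placed_def six_in_def)
  \<comment> \<open>Finiteness matters: \<open>mset_set\<close> of an infinite set is empty and
    would hide the edges of a block.\<close>
  have edges_sub: "edges B \<subseteq> edges ?K" if "B \<in># ?F" "finite (edges B)" for B
  proof -
    have "edges B \<subseteq> set_mset (covered_edges ?F)"
      using that by (auto simp: covered_edges_def)
    then show ?thesis by (simp add: support)
  qed
  have finE: "finite (edges (placed C6 g))" "finite (edges (placed C6_bar g))"
    for g :: "nat \<Rightarrow> nat"
    by (simp_all add: placed_def edges_C6 edges_C6_bar)
  have hex: "copy_in C6 ?K (placed C6 (id \<circ> (!) xs))" if "xs \<in> set hs" for xs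
  proof -
    have "six_in n xs" using that assms(1) by (auto simp: list_all_iff)
    then show ?thesis
      unfolding copy_in_def subgraph_def verts_complete
      using isomorphic_six_in[of id n xs] sub[OF _ verts_C6] that
      by (intro conjI edges_sub finE) (auto simp: set_mset_blocks)
  qed
  have pri: "copy_in C6_bar ?K (placed C6_bar (id \<circ> (!) xs))" if "xs \<in> set ps" for xs
  proof -
    have "six_in n xs" using that assms(2) by (auto simp: list_all_iff)
    then show ?thesis
      unfolding copy_in_def subgraph_def verts_complete
      using isomorphic_six_in[of id n xs] sub[OF _ verts_C6_bar] that
      by (intro conjI edges_sub finE) (auto simp: set_mset_blocks)
  qed
  have "multicovering C6 C6_bar ?K ?F"
    unfolding multicovering_def support
    using hex pri assms(3,4) by (fastforce simp: set_mset_blocks neq_Nil_conv)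
  moreover have "size (padding ?K ?F) = k"
    using assms(7) by (simp add: padding_def covered)
  ultimately show ?thesis by blast
qed

text \<open>Three hexagons and a prism balance as \<open>3 * 6 + 9 = 21 + 6\<close>. The coverings
  on 8, 9, 10 and 11 vertices balance as \<open>2 * 6 + 2 * 9 = 28 + 2\<close>,
  \<open>5 * 6 + 9 = 36 + 3\<close>, \<open>5 * 6 + 2 * 9 = 45 + 3\<close> and
  \<open>5 * 6 + 3 * 9 = 55 + 2\<close>.\<close>

lemma covering_7: "\<exists>F. multicovering C6 C6_bar (complete_graph 7) F
    \<and> size (padding (complete_graph 7) F) = 6"
proof (rule base_covering)
  let ?hs = "[[3,5,2,0,6,4],[2,5,0,4,6,1],[2,4,3,0,1,6]]"
  let ?ps = "[[2,5,3,4,6,1]]"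
  let ?es = "[(2,4),(3,4),(2,6),(1,6),(2,5),(4,6)] :: (nat \<times> nat) list"
  show "list_all (six_in 7) ?hs" by code_simp
  show "list_all (six_in 7) ?ps" by code_simp
  show "mset (layout ?hs ?ps) = mset (pairs 7 @ ?es)" by code_simp
qed simp_all

lemma covering_8: "\<exists>F. multicovering C6 C6_bar (complete_graph 8) F
    \<and> size (padding (complete_graph 8) F) = 2"
proof (rule base_covering)
  let ?hs = "[[5,6,1,3,7,2],[1,2,0,3,4,7]]"
  let ?ps = "[[4,6,5,2,0,3],[7,1,6,5,0,4]]"
  let ?es = "[(0,6),(4,5)] :: (nat \<times> nat) list"
  show "list_all (six_in 8) ?hs" by code_simp
  show "list_all (six_in 8) ?ps" by code_simp
  show "mset (layout ?hs ?ps) = mset (pairs 8 @ ?es)" by code_simp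
qed simp_all

lemma covering_9: "\<exists>F. multicovering C6 C6_bar (complete_graph 9) F
    \<and> size (padding (complete_graph 9) F) = 3"
proof (rule base_covering)
  let ?hs = "[[2,6,4,3,7,1],[1,2,0,7,6,3],[2,7,8,5,0,3],[4,7,5,6,0,8],[4,8,3,5,1,0]]"
  let ?ps = "[[5,1,2,6,4,8]]"
  let ?es = "[(5,6),(1,2),(4,8)] :: (nat \<times> nat) list"
  show "list_all (six_in 9) ?hs" by code_simp
  show "list_all (six_in 9) ?ps" by code_simp
  show "mset (layout ?hs ?ps) = mset (pairs 9 @ ?es)" by code_simp
qed simp_all

lemma covering_10: "\<exists>F. multicovering C6 C6_bar (complete_graph 10) F
    \<and> size (padding (complete_graph 10) F) = 3"
proof (rule base_covering)
  let ?hs = "[[2,6,3,7,4,1],[7,9,3,5,8,0],[4,9,8,3,0,5],[0,6,3,4,8,1],[5,7,8,2,3,1]]"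
  let ?ps = "[[9,6,2,1,5,7],[2,9,4,8,0,6]]"
  let ?es = "[(2,8),(3,6),(8,9)] :: (nat \<times> nat) list"
  show "list_all (six_in 10) ?hs" by code_simp
  show "list_all (six_in 10) ?ps" by code_simp
  show "mset (layout ?hs ?ps) = mset (pairs 10 @ ?es)" by code_simp
qed simp_all

lemma covering_11: "\<exists>F. multicovering C6 C6_bar (complete_graph 11) F
    \<and> size (padding (complete_graph 11) F) = 2"
proof (rule base_covering)
  let ?hs = "[[4,5,9,10,0,2],[0,5,2,6,7,9],[8,10,2,3,1,9],[2,8,3,6,4,9],[3,7,2,1,6,9]]"
  let ?ps = "[[6,0,5,8,3,7],[10,8,7,5,4,1],[4,6,1,3,0,10]]"
  \<comment> \<open>A single edge is covered three times, and both extra copies count.\<close>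
  let ?es = "[(3,6),(3,6)] :: (nat \<times> nat) list"
  show "list_all (six_in 11) ?hs" by code_simp
  show "list_all (six_in 11) ?ps" by code_simp
  show "mset (layout ?hs ?ps) = mset (pairs 11 @ ?es)" by code_simp
qed simp_all

section \<open>Degrees and edge counts of blocks\<close>

text \<open>These isomorphism invariants are all that the lower bounds use about the shape of a
  block.\<close>

definition regular_graph :: "nat \<Rightarrow> nat \<Rightarrow> nat \<Rightarrow> 'a ugraph \<Rightarrow> bool" where
  "regular_graph k d m G \<longleftrightarrow> finite (verts G) \<and> card (verts G) = k \<and> edges G \<subseteq> nsets (verts G) 2
     \<and> card (edges G) = m \<and> (\<forall>v\<in>verts G. card {e \<in> edges G. v \<in> e} = d)"

text \<open>Edges lie inside \<open>verts G\<close>, so injectivity on the vertices makes the map on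
  edges injective and preserves incidence, hence all the counts.\<close>

lemma regular_graph_isomorphic:
  assumes "regular_graph k d m G" "isomorphic G B"
  shows "regular_graph k d m B"
proof -
  obtain f where f: "bij_betw f (verts G) (verts B)" and E: "edges B = (`) f ` edges G"
    using assms(2) by (auto simp: isomorphic_def)
  have inj: "inj_on f (verts G)" and V: "verts B = f ` verts G"
    using f by (auto simp: bij_betw_def)
  have sub: "edges G \<subseteq> nsets (verts G) 2"
    using assms(1) by (simp add: regular_graph_def)
  then have "\<Union>(edges G) \<subseteq> verts G" by (auto simp: nsets_def)
  then have injE: "inj_on ((`) f) (edges G)"
    using inj inj_on_image inj_on_subset by blast
  have "edges B \<subseteq> nsets (verts B) 2"
    using sub unfolding E V nsets_image[OF inj, symmetric] by (rule image_mono)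
  moreover have "card {e \<in> edges B. f v \<in> e} = card {e \<in> edges G. v \<in> e}"
    if "v \<in> verts G" for v
  proof -
    have "f v \<in> f ` e \<longleftrightarrow> v \<in> e" if "e \<in> edges G" for e
      using that \<open>\<Union>(edges G) \<subseteq> verts G\<close> \<open>v \<in> verts G\<close> inj
      by (intro inj_on_image_mem_iff) auto
    then have "{e \<in> edges B. f v \<in> e} = (`) f ` {e \<in> edges G. v \<in> e}"
      unfolding E by blast
    moreover have "inj_on ((`) f) {e \<in> edges G. v \<in> e}"
      using injE by (rule inj_on_subset) auto
    ultimately show ?thesis by (simp add: card_image)
  qed
  moreover have "finite (verts B)" "card (verts B) = card (verts G)" "card (edges B) = card (edges G)"
    using assms(1) inj injE by (auto simp: V E regular_graph_def card_image)
  ultimately show ?thesis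
    using assms(1) by (auto simp: regular_graph_def V)
qed

text \<open>Distinct codes give distinct edges, so a degree becomes a list length that
  simplification can evaluate.\<close>

lemma degree_edge_of:
  assumes "increasing es"
  shows "card {e \<in> edge_of ` set es. v \<in> e} = length (filter (\<lambda>p. v = fst p \<or> v = snd p) es)"
proof -
  have "{e \<in> edge_of ` set es. v \<in> e} = edge_of ` {p \<in> set es. v = fst p \<or> v = snd p}"
    by auto
  moreover have "inj_on edge_of {p \<in> set es. v = fst p \<or> v = snd p}"
    by (rule inj_on_subset[OF inj_on_edge_of[OF assms]]) auto
  ultimately have "card {e \<in> edge_of ` set es. v \<in> e} = card {p \<in> set es. v = fst p \<or> v = snd p}"
    by (simp add: card_image)
  also have "\<dots> = length (filter (\<lambda>p. v = fst p \<or> v = snd p) es)"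
    using assms distinct_card[of "filter (\<lambda>p. v = fst p \<or> v = snd p) es"]
    by (simp add: increasing_def)
  finally show ?thesis .
qed

lemma card_edge_of:
  assumes "increasing es"
  shows "card (edge_of ` set es) = length es"
  using assms inj_on_edge_of[OF assms] by (simp add: card_image increasing_def distinct_card)

lemma edge_of_subset_nsets:
  assumes "increasing es" "\<forall>p\<in>set es. snd p < n"
  shows "edge_of ` set es \<subseteq> nsets {..<n} 2"
proof -
  have "set es \<subseteq> set (pairs n)"
    using assms by (auto simp: increasing_def set_pairs)
  then show ?thesis by (simp only: edge_of_pairs[symmetric] image_mono)
qed

lemma lessThan_6: "{..<6::nat} = {0,1,2,3,4,5}"
  by auto

lemma regular_C6: "regular_graph 6 2 6 C6"
  unfolding regular_graph_def verts_C6 edges_C6_pairs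
proof (intro conjI)
  show "edge_of ` set hexagon_pairs \<subseteq> nsets {..<6} 2"
    by (rule edge_of_subset_nsets[OF increasing_pairs(1)]) (simp add: hexagon_pairs_def)
  show "\<forall>v\<in>{..<6}. card {e \<in> edge_of ` set hexagon_pairs. v \<in> e} = 2"
    unfolding degree_edge_of[OF increasing_pairs(1)] lessThan_6 by (simp add: hexagon_pairs_def)
  show "card (edge_of ` set hexagon_pairs) = 6"
    unfolding card_edge_of[OF increasing_pairs(1)] by (simp add: hexagon_pairs_def)
qed simp_all

lemma regular_C6_bar: "regular_graph 6 3 9 C6_bar"
  unfolding regular_graph_def verts_C6_bar edges_C6_bar_pairs
proof (intro conjI)
  show "edge_of ` set prism_pairs \<subseteq> nsets {..<6} 2"
    by (rule edge_of_subset_nsets[OF increasing_pairs(2)]) (simp add: prism_pairs_def)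
  show "\<forall>v\<in>{..<6}. card {e \<in> edge_of ` set prism_pairs. v \<in> e} = 3"
    unfolding degree_edge_of[OF increasing_pairs(2)] lessThan_6 by (simp add: prism_pairs_def)
  show "card (edge_of ` set prism_pairs) = 9"
    unfolding card_edge_of[OF increasing_pairs(2)] by (simp add: prism_pairs_def)
qed simp_all

lemma finite_edges: "regular_graph k d m B \<Longrightarrow> finite (edges B)"
  unfolding regular_graph_def using finite_imp_finite_nsets finite_subset by blast

text \<open>Positive degree rules out isolated vertices; hence confining the edges of a block
  confines its vertices.\<close>

lemma verts_subset_Union_edges:
  assumes "regular_graph k d m B" "0 < d"
  shows "verts B \<subseteq> \<Union>(edges B)"
proof
  fix v assume "v \<in> verts B"
  then have "card {e \<in> edges B. v \<in> e} \<noteq> 0"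
    using assms by (simp add: regular_graph_def)
  then have "{e \<in> edges B. v \<in> e} \<noteq> {}" by (metis card.empty)
  then show "v \<in> \<Union>(edges B)" by blast
qed

section \<open>Adding six vertices\<close>

text \<open>The added blocks cover each new edge exactly once and no old one, so the padding stays
  the same. Copies of both kinds are inherited from \<open>F\<close>.\<close>

lemma extend_covering:
  assumes F: "multicovering C6 C6_bar (complete_graph n) F" and n: "8 \<le> n"
  shows "\<exists>F'. multicovering C6 C6_bar (complete_graph (n + 6)) F'
    \<and> size (padding (complete_graph (n + 6)) F') = size (padding (complete_graph n) F)"
proof -
  let ?K = "complete_graph n" and ?K' = "complete_graph (n + 6)"
  define N where "N = {n..<n + 6}"
  define E where "E = nsets N 2 \<union> join {..<n} N"
  have disj: "{..<n} \<inter> N = {}" and card_N: "card N = 6" and un: "{..<n + 6} = {..<n} \<union> N"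
    by (auto simp: N_def)
  then have "tileable E"
    using n unfolding E_def by (intro tileable_extension) auto
  then obtain G where G: "\<forall>B\<in>#G. isomorphic C6 B \<or> isomorphic C6_bar B"
    "covered_edges G = mset_set E"
    by (auto simp: tileable_def tiles_def)
  have K': "edges ?K' = edges ?K \<union> E"
    unfolding edges_complete un nsets_2_Un[OF disj] E_def by (simp add: Un_assoc)
  have fin: "finite (edges ?K)" "finite E"
    by (auto simp: edges_complete E_def N_def intro: finite_imp_finite_nsets finite_join)
  have "edges ?K \<inter> E = {}"
  proof -
    \<comment> \<open>Every edge in \<open>E\<close> has an endpoint in \<open>N\<close>, outside
      the old vertices.\<close>
    have "\<not> e \<subseteq> {..<n}" if "e \<in> E" for e
      using that disj by (auto simp: E_def join_def nsets_2_eq)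
    then show ?thesis by (auto simp: edges_complete nsets_def)
  qed
  then have "mset_set (edges ?K') = mset_set (edges ?K) + mset_set E"
    using fin by (simp add: K' mset_set_Union)
  then have pad: "padding ?K' (F + G) = padding ?K F"
    by (simp add: padding_def G(2))
  \<comment> \<open>\<open>tiles\<close> does not say where a block lies. Its edges are among the
    covered edges \<open>E\<close>, and its vertices are endpoints of these.\<close>
  have sub: "subgraph B ?K'" if "B \<in># G" for B
  proof -
    have "regular_graph 6 2 6 B \<or> regular_graph 6 3 9 B"
      using that G(1) regular_graph_isomorphic[OF regular_C6]
        regular_graph_isomorphic[OF regular_C6_bar] by blast
    then obtain d m where B: "regular_graph 6 d m B" "0 < d"
      using zero_less_numeral by blast
    then have "edges B \<subseteq> set_mset (covered_edges G)"
      using that finite_edges[OF B(1)] by (auto simp: covered_edges_def intro!: bexI[of _ B])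
    then have e: "edges B \<subseteq> edges ?K'" using fin by (simp add: G(2) K' le_supI2)
    then have "\<Union>(edges B) \<subseteq> {..<n + 6}" by (auto simp: edges_complete nsets_def)
    then show ?thesis
      using e verts_subset_Union_edges[OF B] by (auto simp: subgraph_def verts_complete)
  qed
  have mono: "copy_in H ?K' B" if "copy_in H ?K B" for H :: "nat ugraph" and B
    using that by (auto simp: copy_in_def subgraph_def verts_complete K')
  have "multicovering C6 C6_bar ?K' (F + G)"
    unfolding multicovering_def
  proof (intro conjI)
    show "\<forall>B\<in>#F + G. copy_in C6 ?K' B \<or> copy_in C6_bar ?K' B"
    proof
      fix B assume "B \<in># F + G"
      then consider "B \<in># F" | "B \<in># G" by auto
      then show "copy_in C6 ?K' B \<or> copy_in C6_bar ?K' B"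
      proof cases
        case 1
        then show ?thesis using F mono unfolding multicovering_def by blast
      next
        case 2
        then show ?thesis using G(1) sub unfolding copy_in_def by blast
      qed
    qed
    show "\<exists>B\<in>#F + G. copy_in C6 ?K' B" "\<exists>B\<in>#F + G. copy_in C6_bar ?K' B"
      using F mono unfolding multicovering_def by (meson union_iff)+
    show "set_mset (covered_edges (F + G)) = edges ?K'"
      using F fin unfolding multicovering_def by (simp add: G(2) K')
  qed
  then show ?thesis using pad by auto
qed

lemma covering_2_mod_3:
  assumes "n mod 3 = 2" "8 \<le> n"
  shows "\<exists>F. multicovering C6 C6_bar (complete_graph n) F
    \<and> size (padding (complete_graph n) F) = 2"
  using assms
proof (induction n rule: less_induct)
  case (less n)
  \<comment> \<open>Extension moves in steps of six, so the classes 2 and 5 modulo 6 each need a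
    starting case.\<close>
  consider "n = 8" | "n = 11" | "14 \<le> n"
  proof -
    have "n = 8 \<or> n = 11 \<or> 14 \<le> n" using less.prems by presburger
    then show ?thesis using that by blast
  qed
  then show ?case
  proof cases
    case 3
    have "(n - 6) mod 3 = 2"
      using 3 less.prems(1) mod_add_self2[of "n - 6" 3] mod_add_self2[of "n - 6 + 3" 3] by simp
    moreover have m: "n - 6 < n" "8 \<le> n - 6" "n - 6 + 6 = n"
      using 3 by simp_all
    ultimately obtain F where "multicovering C6 C6_bar (complete_graph (n - 6)) F"
      "size (padding (complete_graph (n - 6)) F) = 2"
      using less.IH by blast
    then show ?thesis using extend_covering[of "n - 6" F] m by simp
  qed (use covering_8 covering_11 in simp_all)
qed

section \<open>Counting edges and degrees in a multicovering\<close>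

lemma size_covered_edges:
  assumes "\<forall>B\<in>#F. regular_graph k d m B"
  shows "size (covered_edges F) = m * size F"
  using assms
  by (induction F) (auto simp: regular_graph_def)

definition degree :: "'a set multiset \<Rightarrow> 'a \<Rightarrow> nat" where
  "degree M v = size (filter_mset (\<lambda>e. v \<in> e) M)"

lemma degree_union: "degree (M + N) v = degree M v + degree N v"
  by (simp add: degree_def)

lemma degree_mset_set: "finite E \<Longrightarrow> degree (mset_set E) v = card {e \<in> E. v \<in> e}"
  by (simp add: degree_def)

lemma degree_covered_edges:
  assumes "\<forall>B\<in>#F. regular_graph k d m B"
  shows "degree (covered_edges F) v = d * size {#B \<in># F. v \<in> verts B#}"
  using assms
proof (induction F)
  case (add B F)
  have B: "regular_graph k d m B" using add.prems by simp
  have "{e \<in> edges B. v \<in> e} = {}" if "v \<notin> verts B"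
    using that B by (auto simp: regular_graph_def nsets_def)
  then have "card {e \<in> edges B. v \<in> e} = (if v \<in> verts B then d else 0)"
    using B unfolding regular_graph_def by (metis card.empty)
  then have "degree (mset_set (edges B)) v = (if v \<in> verts B then d else 0)"
    by (simp only: degree_mset_set[OF finite_edges[OF B]])
  then show ?case using add by (simp add: degree_union)
qed (simp add: degree_def)

lemma degree_complete:
  assumes "v < n"
  shows "degree (mset_set (edges (complete_graph n))) v = n - 1"
proof -
  have "{e \<in> edges (complete_graph n). v \<in> e} = (\<lambda>u. {v, u}) ` ({..<n} - {v})"
    using assms by (auto simp: edges_complete nsets_2_eq image_iff doubleton_eq_iff)
  moreover have "inj_on (\<lambda>u. {v, u}) ({..<n} - {v})"
    by (auto simp: inj_on_def doubleton_eq_iff)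
  ultimately show ?thesis
    using assms by (simp add: degree_def card_image edges_complete finite_imp_finite_nsets)
qed

text \<open>Collects the data for the lower bounds. A hexagon has 6 edges and degree 2, a prism 9
  edges and degree 3; counting the covered edges, in all and at each vertex, gives the
  equations.\<close>

lemma multicovering_split:
  assumes "multicovering C6 C6_bar (complete_graph n) F"
  obtains Hs Ps where "F = Hs + Ps" "Hs \<noteq> {#}" "Ps \<noteq> {#}"
    "\<forall>B\<in>#Hs. regular_graph 6 2 6 B" "\<forall>B\<in>#Ps. regular_graph 6 3 9 B"
    "\<forall>B\<in>#Ps. verts B \<subseteq> {..<n}"
    "covered_edges F = mset_set (edges (complete_graph n)) + padding (complete_graph n) F"
    "6 * size Hs + 9 * size Ps = (n choose 2) + size (padding (complete_graph n) F)"
    "\<forall>v<n. n - 1 + degree (padding (complete_graph n) F) v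
      = 2 * size {#B \<in># Hs. v \<in> verts B#} + 3 * size {#B \<in># Ps. v \<in> verts B#}"
proof -
  let ?K = "complete_graph n"
  define Hs where "Hs = {#B \<in># F. isomorphic C6 B#}"
  define Ps where "Ps = {#B \<in># F. \<not> isomorphic C6 B#}"
  have F: "F = Hs + Ps" by (simp add: Hs_def Ps_def)
  have Hs: "\<forall>B\<in>#Hs. regular_graph 6 2 6 B"
    by (auto simp: Hs_def intro: regular_graph_isomorphic regular_C6)
  have Ps: "\<forall>B\<in>#Ps. regular_graph 6 3 9 B"
    using assms by (auto simp: Ps_def multicovering_def copy_in_def
        intro: regular_graph_isomorphic regular_C6_bar)
  \<comment> \<open>With 6 and 9 edges, no block is of both kinds, so the required copy of
    \<open>C6_bar\<close> lands in \<open>Ps\<close>.\<close>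
  have "\<not> isomorphic C6 B" if "isomorphic C6_bar B" for B :: "nat ugraph"
    using that regular_graph_isomorphic[OF regular_C6, of B]
      regular_graph_isomorphic[OF regular_C6_bar, of B]
    by (auto simp: regular_graph_def)
  then have ne: "Hs \<noteq> {#}" "Ps \<noteq> {#}"
    using assms
    unfolding Hs_def Ps_def multicovering_def copy_in_def filter_mset_eq_mempty_iff
    by blast+
  have sub: "\<forall>B\<in>#Ps. verts B \<subseteq> {..<n}"
  proof
    fix B assume "B \<in># Ps"
    then have "B \<in># F" by (simp add: F)
    then have "subgraph B ?K"
      using assms unfolding multicovering_def copy_in_def by blast
    then show "verts B \<subseteq> {..<n}" by (simp add: subgraph_def verts_complete)
  qed
  \<comment> \<open>Multiset subtraction truncates; this containment makes the subtraction in
    \<open>padding\<close> reversible.\<close>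
  have "mset_set (edges ?K) \<subseteq># covered_edges F"
    using assms mset_set_set_mset_msubset[of "covered_edges F"] by (simp add: multicovering_def)
  then have cov: "covered_edges F = mset_set (edges ?K) + padding ?K F"
    by (simp add: padding_def)
  have eq: "6 * size Hs + 9 * size Ps = (n choose 2) + size (padding ?K F)"
  proof -
    have "size (covered_edges F) = 6 * size Hs + 9 * size Ps"
      using size_covered_edges[OF Hs] size_covered_edges[OF Ps] by (simp add: F)
    moreover have "size (covered_edges F) = (n choose 2) + size (padding ?K F)"
      by (subst cov) (simp add: edges_complete)
    ultimately show ?thesis by simp
  qed
  have "n - 1 + degree (padding ?K F) v
      = 2 * size {#B \<in># Hs. v \<in> verts B#} + 3 * size {#B \<in># Ps. v \<in> verts B#}"
    if "v < n" for v
  proof -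
    have "degree (covered_edges F) v
        = 2 * size {#B \<in># Hs. v \<in> verts B#} + 3 * size {#B \<in># Ps. v \<in> verts B#}"
      using degree_covered_edges[OF Hs] degree_covered_edges[OF Ps] by (simp add: F degree_union)
    moreover have "degree (covered_edges F) v = n - 1 + degree (padding ?K F) v"
      by (subst cov) (simp add: degree_union degree_complete that)
    ultimately show ?thesis by simp
  qed
  then show ?thesis using that[OF F ne Hs Ps sub cov eq] by blast
qed

section \<open>Lower bounds on the padding\<close>

text \<open>The number of covered edges is divisible by 3, while \<open>n choose 2\<close> leaves
  remainder 1, so the padding size is 2 modulo 3.\<close>

lemma padding_ge_2_mod_3:
  assumes "multicovering C6 C6_bar (complete_graph n) F" "n mod 3 = 2"
  shows "2 \<le> size (padding (complete_graph n) F)"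
proof -
  obtain Hs Ps :: "nat ugraph multiset"
    where eq: "6 * size Hs + 9 * size Ps = (n choose 2) + size (padding (complete_graph n) F)"
    by (rule multicovering_split[OF assms(1)]) (rule that; assumption)
  \<comment> \<open>The product \<open>m * (m + 1)\<close> is even, so the division in
    \<open>t\<close> is exact.\<close>
  define m t where "m = n div 3" and "t = m * (m + 1) div 2"
  have n: "n = 3 * m + 2" using assms(2) by (simp add: m_def) presburger
  have t: "2 * t = m * (m + 1)" by (simp add: t_def)
  have "n * (n - 1) = 9 * (m * (m + 1)) + 2" by (simp add: n algebra_simps)
  also have "\<dots> = 2 * (9 * t + 1)" using t by simp
  finally have "n choose 2 = 9 * t + 1" by (simp add: choose_two)
  with eq show ?thesis by presburger
qed

lemma missing_vertex:
  fixes n :: nat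
  assumes "regular_graph 6 d m B" "verts B \<subseteq> {..<n}" "6 < n"
  obtains v where "v < n" "v \<notin> verts B"
proof -
  have "verts B \<noteq> {..<n}" using assms by (auto simp: regular_graph_def)
  then show ?thesis using assms(2) that by blast
qed

lemma padding_ge_7:
  assumes "multicovering C6 C6_bar (complete_graph 7) F"
  shows "6 \<le> size (padding (complete_graph 7) F)"
proof -
  obtain Hs Ps where F: "F = Hs + Ps" and ne: "Hs \<noteq> {#}" "Ps \<noteq> {#}"
    and "\<forall>B\<in>#Hs. regular_graph 6 2 6 B"
    and Ps: "\<forall>B\<in>#Ps. regular_graph 6 3 9 B" "\<forall>B\<in>#Ps. verts B \<subseteq> {..<7}"
    and cov: "covered_edges F = mset_set (edges (complete_graph 7)) + padding (complete_graph 7) F"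
    and eq: "6 * size Hs + 9 * size Ps = (7 choose 2) + size (padding (complete_graph 7) F)"
    and deg: "\<forall>v<7. 7 - 1 + degree (padding (complete_graph 7) F) v
      = 2 * size {#B \<in># Hs. v \<in> verts B#} + 3 * size {#B \<in># Ps. v \<in> verts B#}"
    by (rule multicovering_split[OF assms]) (rule that; assumption)
  obtain P Ps' where P: "Ps = add_mset P Ps'"
    using ne(2) by (metis multiset_cases)
  obtain v where v: "v < 7" "v \<notin> verts P"
    using missing_vertex[of 3 9 P 7] Ps by (auto simp: P)
  have "size {#B \<in># Ps. v \<in> verts B#} \<le> size Ps'" "size {#B \<in># Hs. v \<in> verts B#} \<le> size Hs"
    using v(2) by (simp_all add: P size_filter_mset_lesseq)
  moreover have "(7::nat) choose 2 = 21" by (simp add: choose_two)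
  moreover have "size Ps = size Ps' + 1" by (simp add: P)
  \<comment> \<open>With \<open>a\<close> hexagons and \<open>b\<close> prisms, the degree of
    \<open>v\<close> gives \<open>2 a + 3 (b - 1) \<ge> 6\<close>. Hence
    \<open>6 a + 9 b = 3 (2 a + 3 (b - 1)) + 9 \<ge> 27\<close>, which is 6 more than the 21
    edges.\<close>
  ultimately show ?thesis using eq deg[rule_format, OF v(1)] by linarith
qed

text \<open>\<open>mset_set\<close> counts each element at most once. Hence two blocks of a covering
  without padding share no edge.\<close>

lemma disjoint_of_mset_set_subset:
  assumes "mset_set A + mset_set B \<subseteq># mset_set C" "finite A" "finite B"
  shows "A \<inter> B = {}"
proof (rule ccontr)
  assume "A \<inter> B \<noteq> {}"
  then obtain x where "x \<in> A" "x \<in> B" by blast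
  then have "2 \<le> count (mset_set C) x"
    using mset_subset_eq_count[OF assms(1), of x] assms(2,3) by simp
  moreover have "count (mset_set C) x \<le> 1"
    by (cases "finite C"; cases "x \<in> C") auto
  ultimately show False by simp
qed

lemma mset_of_size_2:
  assumes "size M = 2"
  obtains x y where "M = {#x, y#}"
proof -
  obtain x N where "M = add_mset x N" using assms by (metis multiset_cases size_empty zero_neq_numeral)
  moreover from this obtain y where "N = {#y#}"
    using assms size_1_singleton_mset[of N] by auto
  ultimately show ?thesis using that by blast
qed

lemma mset_of_size_3:
  assumes "size M = 3"
  obtains x y z where "M = {#x, y, z#}"
proof -
  obtain x N where M: "M = add_mset x N" using assms by (metis multiset_cases size_empty zero_neq_numeral)
  then have "size N = 2" using assms by simp
  then show ?thesis using M that by (metis mset_of_size_2)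
qed

lemma padding_ge_9:
  assumes "multicovering C6 C6_bar (complete_graph 9) F"
  shows "3 \<le> size (padding (complete_graph 9) F)"
proof (rule ccontr)
  assume small: "\<not> ?thesis"
  obtain Hs Ps where F: "F = Hs + Ps" and ne: "Hs \<noteq> {#}" "Ps \<noteq> {#}"
    and "\<forall>B\<in>#Hs. regular_graph 6 2 6 B"
    and Ps: "\<forall>B\<in>#Ps. regular_graph 6 3 9 B" "\<forall>B\<in>#Ps. verts B \<subseteq> {..<9}"
    and cov: "covered_edges F = mset_set (edges (complete_graph 9)) + padding (complete_graph 9) F"
    and eq: "6 * size Hs + 9 * size Ps = (9 choose 2) + size (padding (complete_graph 9) F)"
    and deg: "\<forall>v<9. 9 - 1 + degree (padding (complete_graph 9) F) v
      = 2 * size {#B \<in># Hs. v \<in> verts B#} + 3 * size {#B \<in># Ps. v \<in> verts B#}"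
    by (rule multicovering_split[OF assms]) (rule that; assumption)
  have "(9::nat) choose 2 = 36" by (simp add: choose_two)
  moreover have "0 < size Hs" "0 < size Ps"
    using ne nonempty_has_size by blast+
  \<comment> \<open>A padding size below 3 must be 0 by divisibility, and
    \<open>2 a + 3 b = 12\<close> with both positive leaves only \<open>b = 2\<close>.\<close>
  ultimately have "size (padding (complete_graph 9) F) = 0" "size Ps = 2"
    using eq small by presburger+
  then obtain P Q where PQ: "Ps = {#P, Q#}" and pad: "padding (complete_graph 9) F = {#}"
    using mset_of_size_2 size_eq_0_iff_empty by metis
  have P: "regular_graph 6 3 9 P" "verts P \<subseteq> {..<9}" and Q: "regular_graph 6 3 9 Q" "verts Q \<subseteq> {..<9}"
    using Ps by (auto simp: PQ)
  have "v \<in> verts P \<longleftrightarrow> v \<in> verts Q" if "v < 9" for v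
  proof -
    \<comment> \<open>The degree 8 is even and hexagons contribute evenly, so \<open>v\<close> lies
      in both prisms or in neither.\<close>
    have "even (3 * size {#B \<in># Ps. v \<in> verts B#})"
      using deg[rule_format, OF that] by (simp add: pad degree_def) presburger
    then show ?thesis by (auto simp: PQ split: if_splits)
  qed
  then have V: "verts P = verts Q" using P Q by blast
  have "mset_set (edges P) + mset_set (edges Q) \<subseteq># covered_edges F"
    by (simp add: F PQ)
  then have "edges P \<inter> edges Q = {}"
    using disjoint_of_mset_set_subset finite_edges P Q by (metis cov pad add.right_neutral)
  then have "card (edges P \<union> edges Q) = 18"
    using P Q finite_edges by (subst card_Un_disjoint) (auto simp: regular_graph_def)
  moreover have "card (edges P \<union> edges Q) \<le> card (nsets (verts P) 2)"
    using P Q V by (intro card_mono finite_imp_finite_nsets) (auto simp: regular_graph_def)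
  ultimately show False
    using P by (simp add: regular_graph_def choose_two)
qed

text \<open>The two vertices of \<open>P\<close> outside \<open>W\<close> meet at most
  \<open>3 + 3\<close> of its 9 edges.\<close>

lemma card_edges_inside:
  assumes "regular_graph 6 3 9 P" "W \<subseteq> verts P" "card W = 4"
  shows "3 \<le> card (edges P \<inter> nsets W 2)"
proof -
  have fin: "finite (verts P)" "finite (edges P)"
    using assms(1) finite_edges[OF assms(1)] by (simp_all add: regular_graph_def)
  have "card (verts P - W) = 2"
    using card_Diff_subset[OF finite_subset[OF assms(2) fin(1)] assms(2)] assms(1,3)
    by (simp add: regular_graph_def)
  then obtain x y where xy: "verts P - W = {x, y}" by (auto simp: card_2_iff)
  let ?I = "edges P \<inter> nsets W 2"
  let ?D = "\<lambda>v. {e \<in> edges P. v \<in> e}"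
  have "edges P \<subseteq> ?I \<union> (?D x \<union> ?D y)"
  proof
    fix e assume e: "e \<in> edges P"
    then have "e \<in> nsets (verts P) 2" using assms(1) by (auto simp: regular_graph_def)
    then show "e \<in> ?I \<union> (?D x \<union> ?D y)"
      using e xy by (auto simp: nsets_def)
  qed
  then have "card (edges P) \<le> card (?I \<union> (?D x \<union> ?D y))"
    using fin by (intro card_mono) auto
  also have "\<dots> \<le> card ?I + (card (?D x) + card (?D y))"
    using card_Un_le[of ?I "?D x \<union> ?D y"] card_Un_le[of "?D x" "?D y"] by linarith
  finally have "9 \<le> card ?I + (card (?D x) + card (?D y))"
    using assms(1) by (simp add: regular_graph_def)
  moreover have "x \<in> verts P" "y \<in> verts P" using xy by auto
  ultimately show ?thesis using assms(1) by (simp add: regular_graph_def)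
qed

lemma padding_ge_10:
  assumes "multicovering C6 C6_bar (complete_graph 10) F"
  shows "3 \<le> size (padding (complete_graph 10) F)"
proof (rule ccontr)
  assume small: "\<not> ?thesis"
  obtain Hs Ps where F: "F = Hs + Ps" and ne: "Hs \<noteq> {#}" "Ps \<noteq> {#}"
    and "\<forall>B\<in>#Hs. regular_graph 6 2 6 B"
    and Ps: "\<forall>B\<in>#Ps. regular_graph 6 3 9 B" "\<forall>B\<in>#Ps. verts B \<subseteq> {..<10}"
    and cov: "covered_edges F = mset_set (edges (complete_graph 10)) + padding (complete_graph 10) F"
    and eq: "6 * size Hs + 9 * size Ps = (10 choose 2) + size (padding (complete_graph 10) F)"
    and deg: "\<forall>v<10. 10 - 1 + degree (padding (complete_graph 10) F) v
      = 2 * size {#B \<in># Hs. v \<in> verts B#} + 3 * size {#B \<in># Ps. v \<in> verts B#}"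
    by (rule multicovering_split[OF assms]) (rule that; assumption)
  have "(10::nat) choose 2 = 45" by (simp add: choose_two)
  moreover have "0 < size Hs" "0 < size Ps"
    using ne nonempty_has_size by blast+
  \<comment> \<open>Again divisibility forces padding size 0, and \<open>2 a + 3 b = 15\<close> with
    both positive leaves \<open>b = 1\<close> or \<open>b = 3\<close>.\<close>
  ultimately have "size (padding (complete_graph 10) F) = 0" and size: "size Ps = 1 \<or> size Ps = 3"
    using eq small by presburger+
  then have pad: "padding (complete_graph 10) F = {#}" by simp
  have odd: "odd (size {#B \<in># Ps. v \<in> verts B#})" if "v < 10" for v
    using deg[rule_format, OF that] by (simp add: pad degree_def) presburger
  \<comment> \<open>A single prism misses some vertex, which would then lie in zero prisms, an even
    number.\<close>
  have "size Ps \<noteq> 1"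
  proof
    assume "size Ps = 1"
    then obtain P where P: "Ps = {#P#}" by (metis size_1_singleton_mset)
    then obtain v where "v < 10" "v \<notin> verts P"
      using missing_vertex[of 3 9 P 10] Ps by auto
    then show False using odd[of v] by (simp add: P)
  qed
  then obtain P Q R where PQR: "Ps = {#P, Q, R#}"
    using size mset_of_size_3 by metis
  have P: "regular_graph 6 3 9 P" "verts P \<subseteq> {..<10}"
    and Q: "regular_graph 6 3 9 Q" "verts Q \<subseteq> {..<10}"
    and R: "regular_graph 6 3 9 R" "verts R \<subseteq> {..<10}"
    using Ps by (auto simp: PQR)
  have finV: "finite (verts P)" "finite (verts Q)" "finite (verts R)"
    and cardV: "card (verts P) = 6" "card (verts Q) = 6" "card (verts R) = 6"
    using P Q R by (auto simp: regular_graph_def)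
  define W where "W = verts P \<inter> verts Q"
  have one_or_three: "(v \<in> verts P \<longleftrightarrow> v \<in> verts Q) \<longleftrightarrow> v \<in> verts R" if "v < 10" for v
    using odd[OF that] by (auto simp: PQR split: if_splits)
  \<comment> \<open>A vertex of \<open>R\<close> lying in a second prism lies in all three. Two
    applications of inclusion-exclusion then give
    \<open>6 + 6 + 6 = 10 + 2 * card W\<close>.\<close>
  have "(verts P \<union> verts Q) \<inter> verts R = W"
    using one_or_three R(2) P(2) by (auto simp: W_def)
  moreover have "verts P \<union> verts Q \<union> verts R = {..<10}"
    using one_or_three P(2) Q(2) R(2) by auto
  moreover have "card (verts P) + card (verts Q) = card (verts P \<union> verts Q) + card W"
    unfolding W_def using finV by (intro card_Un_Int)
  moreover have "card (verts P \<union> verts Q) + card (verts R)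
      = card (verts P \<union> verts Q \<union> verts R) + card ((verts P \<union> verts Q) \<inter> verts R)"
    using finV by (intro card_Un_Int) auto
  ultimately have card_W: "card W = 4" using cardV by simp
  have W: "W \<subseteq> verts P" "W \<subseteq> verts Q" "W \<subseteq> verts R"
    using one_or_three P(2) by (auto simp: W_def)
  have finE: "finite (edges P)" "finite (edges Q)" "finite (edges R)"
    using P(1) Q(1) R(1) finite_edges by blast+
  have cov: "covered_edges F = mset_set (edges (complete_graph 10))"
    using cov pad by simp
  have "mset_set (edges P) + mset_set (edges Q) \<subseteq># covered_edges F"
    "mset_set (edges P) + mset_set (edges R) \<subseteq># covered_edges F"
    "mset_set (edges Q) + mset_set (edges R) \<subseteq># covered_edges F"
    unfolding F PQR by (simp_all add: subseteq_mset_def)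
  then have disj: "edges P \<inter> edges Q = {}" "edges P \<inter> edges R = {}" "edges Q \<inter> edges R = {}"
    unfolding cov using disjoint_of_mset_set_subset finE by metis+
  let ?W = "nsets W 2"
  have "card ((edges P \<inter> ?W) \<union> (edges Q \<inter> ?W) \<union> (edges R \<inter> ?W))
      = card (edges P \<inter> ?W) + card (edges Q \<inter> ?W) + card (edges R \<inter> ?W)"
    using finE disj by (subst card_Un_disjoint; (subst card_Un_disjoint)?) auto
  moreover have "card ((edges P \<inter> ?W) \<union> (edges Q \<inter> ?W) \<union> (edges R \<inter> ?W)) \<le> card ?W"
    using finV(1) W(1) by (intro card_mono finite_imp_finite_nsets) (auto intro: finite_subset)
  moreover have "card ?W = 6" by (simp add: card_W choose_two)
  ultimately show False
    using card_edges_inside[OF P(1) W(1) card_W] card_edges_inside[OF Q(1) W(2) card_W]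
      card_edges_inside[OF R(1) W(3) card_W] by linarith
qed

section \<open>From bounds and witnesses to minimum paddings\<close>

lemma minimum_padding_sizeI:
  assumes "\<exists>F. multicovering G H K F \<and> size (padding K F) = k"
    and "\<And>F. multicovering G H K F \<Longrightarrow> k \<le> size (padding K F)"
  shows "minimum_padding_size G H K k"
proof -
  obtain F where F: "multicovering G H K F" "size (padding K F) = k"
    using assms(1) by blast
  then have "minimum_multicovering G H K F"
    using assms(2) by (simp add: minimum_multicovering_def)
  moreover have "size (padding K F') = k" if "minimum_multicovering G H K F'" for F'
    using that F assms(2) unfolding minimum_multicovering_def by (metis le_antisym)
  ultimately show ?thesis by (auto simp: minimum_padding_size_def)
qed

theorem theorem3:
  shows "(\<forall>n::nat. n mod 3 = 2 \<and> n \<ge> 8 \<longrightarrow>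
            minimum_padding_size C6 C6_bar (complete_graph n) 2)
       \<and> minimum_padding_size C6 C6_bar (complete_graph 7) 6
       \<and> minimum_padding_size C6 C6_bar (complete_graph 9) 3
       \<and> minimum_padding_size C6 C6_bar (complete_graph 10) 3"
  using covering_2_mod_3 padding_ge_2_mod_3 covering_7 padding_ge_7 covering_9 padding_ge_9
    covering_10 padding_ge_10
  by (intro conjI allI impI minimum_padding_sizeI) auto

end
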